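(* Let $h>0$ and suppose the decentralized integral control $\dot u_j=-K_j\omega_j$, $j\in V$, is applied with gains $K_j=h/a_j$ for all $j\in V$, after a perturbation in which the uncontrollable power at one (arbitrary) bus changes by $\Delta p$, i.e. $p_k=p^0_k+\Delta p$ for some bus $k\in V$ and $p_j=p^0_j$ for $j\ne k$. Then the steady-state cost $\sum_{j\in V}\frac12 a_ju_j^2$ of the adjustable power $u$ under this control is at most $$\frac{4(\Delta p)^2\, n\, h}{b\,\lambda_2}$$ more than the optimal cost of the economic dispatch problem, where $n=|V|$, $\lambda_2$ is the algebraic connectivity of the unweighted graph $G$, and $b$ is the minimum absolute value of the power line susceptances.
   Context: The power grid is a connected graph $G=(V,E)$ with $n=|V|$ buses and $m=|E|$ power lines; $V$ is partitioned into generator buses $V_G$ and load buses $V_L$. Lines are lossless, and $B_{jk}=B_{kj}>0$ is the absolute value of the susceptance of line $(j,k)\in E$ ($B_{jk}=0$ if $(j,k)\notin E$); $b=\min_{(j,k)\in E}B_{jk}$. The algebraic connectivity $\lambda_2$ is the second smallest eigenvalue of the unweighted graph Laplacian of $G$. At bus $j$, $\theta_j$ is the phase angle (in the frame rotating at nominal frequency), $\omega_j=\dot\theta_j$ is the frequency deviation from nominal, $p_j$ is the unadjustable net generation (positive for generation, negative for load), and $u_j$ is the controllable net generation. The DC power flow dynamics, with inertias $M_j>0$ and coefficients $D_j>0$, are $$M_j\dot\omega_j=-D_j\omega_j+p_j+u_j-\sum_{k\in V}B_{jk}(\theta_j-\theta_k)\quad (j\in V_G),$$ $$0=-D_j\omega_j+p_j+u_j-\sum_{k\in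 V}B_{jk}(\theta_j-\theta_k)\quad (j\in V_L).$$ Before the perturbation the system is in steady state with $u=0$, $\omega=0$, unadjustable power $p^0$ with $\sum_{j}p^0_j=0$, and phase angles $\theta^0$ satisfying $p^0_j=\sum_{k}B_{jk}(\theta^0_j-\theta^0_k)$ for all $j$. At time $0$ the unadjustable power changes to the constant vector $p$, and the controlled dynamics evolve from $\theta(0)=\theta^0$, $u(0)=0$ (and $\omega_j(0)=0$ for $j\in V_G$). The steady state after the perturbation is the limit $(\theta,u)$ (up to a common shift the system settles with $\omega=0$, $\dot\omega=0$) reached as $t\to\infty$; in it $p_j+u_j=\sum_kB_{jk}(\theta_j-\theta_k)$ for all $j\in V$, and, integrating the control law, $u_j=-K_j(\theta_j-\theta^0_j)$ for all $j\in V$. It is taken as known that the controlled system converges to such a steady state for any $K_j>0$. The economic dispatch problem, with cost coefficients $a_j>0$, is to minimize $\sum_{j\in V}\frac12a_ju_j^2$ over $(u,\theta)\in\mathbb R^n\times\mathbb R^n$ subject to $p_j+u_j-\sum_{k\in V}B_{jk}(\theta_j-\theta_k)=0$ for all $j\in V$, with $p$ the unadjustable power after the perturbation; the optimal cost is its minimum value. Line limits and generator capacity constraints are ignored. *)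

theory Defs
  imports "HOL-Analysis.Analysis" "HOL-Computational_Algebra.Polynomial"
begin

(* The buses are the elements of a finite type 'v; a line between j and k is represented by
   both (j, k) and (k, j). *)
definition connected_simple_graph :: "('v::finite \<times> 'v) set \<Rightarrow> bool" where
  "connected_simple_graph E \<longleftrightarrow> sym E \<and> irrefl E \<and> (\<forall>j k. (j, k) \<in> E\<^sup>*)"

definition is_susceptance :: "('v::finite \<times> 'v) set \<Rightarrow> ('v \<Rightarrow> 'v \<Rightarrow> real) \<Rightarrow> bool" where
  "is_susceptance E B \<longleftrightarrow>
     (\<forall>j k. B j k = B k j) \<and>
     (\<forall>j k. (j, k) \<in> E \<longrightarrow> B j k > 0) \<and>
     (\<forall>j k. (j, k) \<notin> E \<longrightarrow> B j k = 0)"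

definition min_susceptance :: "('v::finite \<times> 'v) set \<Rightarrow> ('v \<Rightarrow> 'v \<Rightarrow> real) \<Rightarrow> real" where
  "min_susceptance E B = Min ((\<lambda>(j, k). B j k) ` E)"

definition laplacian :: "('v::finite \<times> 'v) set \<Rightarrow> real^'v^'v" where
  "laplacian E = (\<chi> j k. if j = k then real (card {l. (j, l) \<in> E})
                         else if (j, k) \<in> E then -1 else 0)"

definition char_polynomial :: "real^'v^'v \<Rightarrow> real poly" where
  "char_polynomial A = det (\<chi> j k. (if j = k then [:0, 1:] else 0) - [:A $ j $ k:])"

(* The real eigenvalues in nondecreasing order, repeated according to multiplicity. *)
definition eigenvalue_list :: "real^'v^'v \<Rightarrow> real list" where
  "eigenvalue_list A = sorted_list_of_multiset (proots (char_polynomial A))"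

(* List indices start at 0, so index 1 is the second smallest eigenvalue. *)
definition algebraic_connectivity :: "('v::finite \<times> 'v) set \<Rightarrow> real" where
  "algebraic_connectivity E = eigenvalue_list (laplacian E) ! 1"

definition net_outflow :: "('v::finite \<Rightarrow> 'v \<Rightarrow> real) \<Rightarrow> ('v \<Rightarrow> real) \<Rightarrow> 'v \<Rightarrow> real" where
  "net_outflow B \<theta> j = (\<Sum>k\<in>UNIV. B j k * (\<theta> j - \<theta> k))"

(* Generator buses are those in VG, load buses those in - VG.  A load bus has no inertia, so its
   frequency deviation at time 0 is determined by the algebraic equation rather than prescribed. *)
definition controlled_trajectory ::
  "('v::finite \<Rightarrow> 'v \<Rightarrow> real) \<Rightarrow> 'v set \<Rightarrow> ('v \<Rightarrow> real) \<Rightarrow> ('v \<Rightarrow> real) \<Rightarrow> ('v \<Rightarrow> real) \<Rightarrow>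
   ('v \<Rightarrow> real) \<Rightarrow> ('v \<Rightarrow> real) \<Rightarrow>
   (real \<Rightarrow> 'v \<Rightarrow> real) \<Rightarrow> (real \<Rightarrow> 'v \<Rightarrow> real) \<Rightarrow> (real \<Rightarrow> 'v \<Rightarrow> real) \<Rightarrow> bool" where
  "controlled_trajectory B VG M D K p \<theta>0 \<theta> \<omega> u \<longleftrightarrow>
     (\<forall>j. \<theta> 0 j = \<theta>0 j) \<and> (\<forall>j. u 0 j = 0) \<and> (\<forall>j\<in>VG. \<omega> 0 j = 0) \<and>
     (\<forall>t\<ge>0.
        (\<forall>j. ((\<lambda>s. \<theta> s j) has_real_derivative \<omega> t j) (at t within {0..})) \<and>
        (\<forall>j. ((\<lambda>s. u s j) has_real_derivative - K j * \<omega> t j) (at t within {0..})) \<and>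
        (\<forall>j\<in>VG. \<exists>\<omega>'. ((\<lambda>s. \<omega> s j) has_real_derivative \<omega>') (at t within {0..}) \<and>
            M j * \<omega>' = - D j * \<omega> t j + p j + u t j - net_outflow B (\<theta> t) j) \<and>
        (\<forall>j\<in>- VG. 0 = - D j * \<omega> t j + p j + u t j - net_outflow B (\<theta> t) j))"

(* That the frequency deviations tend to 0 and that the limit satisfies the power balance
   equations is not required here: along a controlled trajectory both follow from convergence. *)
definition settles_at ::
  "(real \<Rightarrow> 'v::finite \<Rightarrow> real) \<Rightarrow> (real \<Rightarrow> 'v \<Rightarrow> real) \<Rightarrow> ('v \<Rightarrow> real) \<Rightarrow> ('v \<Rightarrow> real) \<Rightarrow> bool" where
  "settles_at \<theta> u \<theta>s us \<longleftrightarrow>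
     (\<forall>j. ((\<lambda>t. \<theta> t j) \<longlongrightarrow> \<theta>s j) at_top) \<and> (\<forall>j. ((\<lambda>t. u t j) \<longlongrightarrow> us j) at_top)"

definition cost :: "('v::finite \<Rightarrow> real) \<Rightarrow> ('v \<Rightarrow> real) \<Rightarrow> real" where
  "cost a u = (\<Sum>j\<in>UNIV. 1 / 2 * a j * (u j)\<^sup>2)"

definition dispatch_feasible ::
  "('v::finite \<Rightarrow> 'v \<Rightarrow> real) \<Rightarrow> ('v \<Rightarrow> real) \<Rightarrow> (('v \<Rightarrow> real) \<times> ('v \<Rightarrow> real)) set" where
  "dispatch_feasible B p = {(u, \<theta>). \<forall>j. p j + u j - net_outflow B \<theta> j = 0}"

definition optimal_cost ::
  "('v::finite \<Rightarrow> real) \<Rightarrow> ('v \<Rightarrow> 'v \<Rightarrow> real) \<Rightarrow> ('v \<Rightarrow> real) \<Rightarrow> real" where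
  "optimal_cost a B p = (LEAST c. c \<in> (\<lambda>(u, \<theta>). cost a u) ` dispatch_feasible B p)"

end

theory Submission
  imports Defs
begin

text \<open>With \<open>d = \<theta>s - \<theta>0\<close>, the steady state satisfies \<open>a j * us j = - h * d j\<close> and
  \<open>L d = \<Delta>p e_k + us\<close>, where \<open>L\<close> is the Laplacian weighted by \<open>B\<close>.  An optimal dispatch has equal
  marginal costs \<open>a j * u j\<close>, so the excess cost is \<open>h\<^sup>2 / 2\<close> times the sum of \<open>(x j)\<^sup>2 / a j\<close>, where
  \<open>x\<close> is \<open>d\<close> minus its mean with weights \<open>1 / a\<close>.  Pairing the flow equation with \<open>x\<close> turns this into
  \<open>h / 2 * (\<Delta>p * x k - x \<bullet> L x)\<close>.  With \<open>y\<close> the centring of \<open>x\<close> at its unweighted mean,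
  \<open>x \<bullet> L x \<ge> b * \<lambda>2 * (y \<bullet> y)\<close>, while \<open>(x k)\<^sup>2 \<le> 2 * (y \<bullet> y)\<close> because \<open>x\<close> takes both signs or
  vanishes at \<open>k\<close>; completing the square bounds the excess by \<open>h * \<Delta>p\<^sup>2 / (4 * b * \<lambda>2)\<close>.\<close>

section \<open>Flows on a weighted graph\<close>

lemma net_outflow_diff:
  "net_outflow B (\<lambda>i. x i - y i) j = net_outflow B x j - net_outflow B y j"
  unfolding net_outflow_def by (simp add: sum_subtractf[symmetric] algebra_simps)

lemma net_outflow_diff_const:
  "net_outflow B (\<lambda>i. x i - c) j = net_outflow B x j"
  unfolding net_outflow_def by simp

text \<open>Summation by parts: the double sum is averaged with its index-swapped copy, using
  symmetry of \<open>B\<close>. A constant \<open>w\<close> gives conservation, \<open>w = x\<close>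
  the energy, and exchanging \<open>w\<close> and \<open>x\<close> self-adjointness.\<close>

lemma sum_mult_net_outflow:
  assumes "is_susceptance E B"
  shows "2 * (\<Sum>j\<in>UNIV. w j * net_outflow B x j)
    = (\<Sum>j\<in>UNIV. \<Sum>k\<in>UNIV. B j k * ((w j - w k) * (x j - x k)))"
proof -
  have sym: "B j k = B k j" for j k
    using assms by (auto simp: is_susceptance_def)
  define S where "S = (\<Sum>j\<in>UNIV. \<Sum>k\<in>UNIV. w j * (B j k * (x j - x k)))"
  have "S = (\<Sum>k\<in>UNIV. \<Sum>j\<in>UNIV. w j * (B j k * (x j - x k)))"
    unfolding S_def by (rule sum.swap)
  also have "\<dots> = (\<Sum>j\<in>UNIV. \<Sum>k\<in>UNIV. - w k * (B j k * (x j - x k)))"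
    using sym by (intro sum.cong refl) (simp add: algebra_simps)
  finally have "S + S = (\<Sum>j\<in>UNIV. \<Sum>k\<in>UNIV. w j * (B j k * (x j - x k)))
      + (\<Sum>j\<in>UNIV. \<Sum>k\<in>UNIV. - w k * (B j k * (x j - x k)))"
    by (simp add: S_def)
  also have "\<dots> = (\<Sum>j\<in>UNIV. \<Sum>k\<in>UNIV. B j k * ((w j - w k) * (x j - x k)))"
    unfolding sum.distrib[symmetric]
    by (intro sum.cong refl) (simp add: algebra_simps)
  finally show ?thesis
    by (simp add: S_def net_outflow_def sum_distrib_left)
qed

lemma sum_net_outflow:
  assumes "is_susceptance E B"
  shows "(\<Sum>j\<in>UNIV. net_outflow B x j) = 0"
  using sum_mult_net_outflow[OF assms, of "\<lambda>_. 1" x] by simp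

lemma sum_mult_net_outflow_commute:
  assumes "is_susceptance E B"
  shows "(\<Sum>j\<in>UNIV. w j * net_outflow B x j) = (\<Sum>j\<in>UNIV. x j * net_outflow B w j)"
  using sum_mult_net_outflow[OF assms, of w x] sum_mult_net_outflow[OF assms, of x w]
  by (simp add: mult.commute)

lemma susceptance_nonneg:
  assumes "is_susceptance E B"
  shows "B j k \<ge> 0"
  using assms unfolding is_susceptance_def by (metis less_eq_real_def)

section \<open>Energy and kernel of the weighted Laplacian\<close>

lemma energy_nonneg:
  assumes "is_susceptance E B"
  shows "(\<Sum>j\<in>UNIV. x j * net_outflow B x j) \<ge> 0"
proof -
  have "0 \<le> (\<Sum>j\<in>UNIV. \<Sum>k\<in>UNIV. B j k * ((x j - x k) * (x j - x k)))"
    by (intro sum_nonneg mult_nonneg_nonneg susceptance_nonneg[OF assms] zero_le_square)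
  then show ?thesis
    using sum_mult_net_outflow[OF assms, of x x] by linarith
qed

text \<open>A vanishing sum of nonnegative terms vanishes termwise; positive susceptances then
  equate \<open>x\<close> along each line, and connectivity spreads this to all buses.\<close>

lemma energy_eq_0_imp_const:
  assumes B: "is_susceptance E B" and E: "connected_simple_graph E"
    and 0: "(\<Sum>j\<in>UNIV. x j * net_outflow B x j) = 0"
  shows "x i = x j"
proof -
  have nonneg: "0 \<le> B j k * ((x j - x k) * (x j - x k))" for j k
    by (intro mult_nonneg_nonneg susceptance_nonneg[OF B] zero_le_square)
  have "(\<Sum>j\<in>UNIV. \<Sum>k\<in>UNIV. B j k * ((x j - x k) * (x j - x k))) = 0"
    using sum_mult_net_outflow[OF B, of x x] 0 by simp
  then have "B j k * ((x j - x k) * (x j - x k)) = 0" for j k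
    using nonneg by (simp add: sum_nonneg_eq_0_iff sum_nonneg)
  then have step: "x j = x k" if "(j, k) \<in> E" for j k
    using that B unfolding is_susceptance_def by (metis less_numeral_extra(3) mult_eq_0_iff
        right_minus_eq)
  have "(i, j) \<in> E\<^sup>*"
    using E by (simp add: connected_simple_graph_def)
  then show ?thesis
    by induction (auto dest: step)
qed

lemma net_outflow_eq_0_imp_eq_0:
  fixes x :: "'v::finite \<Rightarrow> real"
  assumes B: "is_susceptance E B" and E: "connected_simple_graph E"
    and 0: "\<And>j. net_outflow B x j = 0" and sum: "(\<Sum>j\<in>UNIV. x j) = 0"
  shows "x i = 0"
proof -
  have "x j = x i" for j
    by (rule energy_eq_0_imp_const[OF B E]) (simp add: 0)
  then have "(\<Sum>j\<in>UNIV. x j) = (\<Sum>j\<in>(UNIV :: 'v set). x i)"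
    by (intro sum.cong refl)
  then show ?thesis
    using sum by simp
qed

text \<open>Adding the all-ones matrix to the weighted Laplacian makes it injective, hence surjective,
  and does not affect the equation on vectors of sum zero.\<close>

lemma net_outflow_surj:
  fixes q :: "'v::finite \<Rightarrow> real"
  assumes B: "is_susceptance E B" and E: "connected_simple_graph E"
    and q: "(\<Sum>j\<in>UNIV. q j) = 0"
  shows "\<exists>x. \<forall>j. net_outflow B x j = q j"
proof -
  define f where "f = (\<lambda>v::real^'v. (\<chi> j. net_outflow B (($) v) j + (\<Sum>i\<in>UNIV. v $ i)) :: real^'v)"
  \<comment> \<open>The flow part has total zero, so an image vector of sum zero forces the all-ones
    term to vanish, and what remains is the plain flow.\<close>
  have f_sum: "(\<Sum>j\<in>UNIV. f v $ j) = real CARD('v) * (\<Sum>i\<in>UNIV. v $ i)" for v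
    by (simp add: f_def sum.distrib sum_net_outflow[OF B])
  have f_net: "net_outflow B (($) v) j = f v $ j" if "(\<Sum>j\<in>UNIV. f v $ j) = 0" for v j
    using that f_sum[of v] by (simp add: f_def)
  have lin: "linear f"
  proof (rule linearI)
    fix v w :: "real^'v" and c :: real
    have "net_outflow B (($) (v + w)) j = net_outflow B (($) v) j + net_outflow B (($) w) j"
      "net_outflow B (($) (c *\<^sub>R v)) j = c * net_outflow B (($) v) j" for j
      by (simp_all add: net_outflow_def sum_distrib_left algebra_simps flip: sum.distrib)
    then show "f (v + w) = f v + f w" "f (c *\<^sub>R v) = c *\<^sub>R f v"
      by (simp_all add: f_def vec_eq_iff sum.distrib sum_distrib_left distrib_left)
  qed
  have "inj f"
    unfolding linear_injective_0[OF lin]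
  proof (intro allI impI)
    fix v assume v: "f v = 0"
    have "v $ i = 0" for i
      using f_net[of v] f_sum[of v] v
      by (intro net_outflow_eq_0_imp_eq_0[OF B E, of "($) v"]) auto
    then show "v = 0"
      by (simp add: vec_eq_iff)
  qed
  with lin have "surj f"
    by (rule linear_inj_imp_surj)
  then obtain v where "f v = (\<chi> j. q j)"
    by (metis surj_def)
  then show ?thesis
    using f_net[of v] q by (intro exI[of _ "($) v"]) auto
qed

section \<open>The Laplacian spectrum\<close>

text \<open>Unit susceptances, which make the unweighted Laplacian an instance of
  \<open>net_outflow\<close>, so that the flow lemmas apply to it.\<close>

definition adjacency :: "('v \<times> 'v) set \<Rightarrow> 'v \<Rightarrow> 'v \<Rightarrow> real" where
  "adjacency E j k = of_bool ((j, k) \<in> E)"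

lemma is_susceptance_adjacency:
  assumes "connected_simple_graph E"
  shows "is_susceptance E (adjacency E)"
  using assms
  by (auto simp: is_susceptance_def adjacency_def connected_simple_graph_def dest: symD)

lemma laplacian_mult_vec:
  fixes E :: "('v::finite \<times> 'v) set"
  assumes "connected_simple_graph E"
  shows "(laplacian E *v v) $ j = net_outflow (adjacency E) (($) v) j"
proof -
  \<comment> \<open>A loop would raise the degree on the diagonal without contributing to the
    flow.\<close>
  have irr: "(j, j) \<notin> E"
    using assms by (auto simp: connected_simple_graph_def irrefl_def)
  have "(\<Sum>k\<in>UNIV. adjacency E j k) = real (card {l. (j, l) \<in> E})"
    by (simp add: adjacency_def of_bool_def sum.If_cases)
  moreover have "(laplacian E *v v) $ j
      = (\<Sum>k\<in>UNIV. (if k = j then real (card {l. (j, l) \<in> E}) * v $ k else 0) - adjacency E j k * v $ k)"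
    unfolding matrix_vector_mult_def
    using irr by (auto simp: laplacian_def adjacency_def intro!: sum.cong)
  ultimately show ?thesis
    by (simp add: net_outflow_def sum_subtractf right_diff_distrib flip: sum_distrib_right)
qed

section \<open>The characteristic polynomial and its root at zero\<close>

text \<open>Evaluation at a point is a ring homomorphism, so it commutes with the determinant; this
  carries questions on \<open>char_polynomial\<close> over to real matrices.\<close>

lemma poly_det:
  fixes A :: "'a::comm_ring_1 poly^'n^'n"
  shows "poly (det A) x = det (\<chi> i j. poly (A $ i $ j) x)"
  by (simp add: det_def poly_sum poly_prod)

lemma poly_char_polynomial:
  "poly (char_polynomial A) x = det (x *\<^sub>R mat 1 - A)"
  unfolding char_polynomial_def poly_det
  by (rule arg_cong[where f = det]) (auto simp: vec_eq_iff mat_def)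

lemma det_eq_0_iff_ker:
  fixes A :: "real^'n^'n"
  shows "det A = 0 \<longleftrightarrow> (\<exists>v. v \<noteq> 0 \<and> A *v v = 0)"
  by (metis invertible_det_nz invertible_left_inverse matrix_left_invertible_ker)

lemma char_polynomial_root_iff:
  "poly (char_polynomial A) x = 0 \<longleftrightarrow> (\<exists>v. v \<noteq> 0 \<and> A *v v = x *\<^sub>R v)"
  unfolding poly_char_polynomial det_eq_0_iff_ker
  by (auto simp: matrix_vector_mult_diff_rdistrib scaleR_matrix_vector_assoc[symmetric])

lemma laplacian_col_sum:
  fixes E :: "('v::finite \<times> 'v) set"
  assumes "connected_simple_graph E"
  shows "(\<Sum>j\<in>UNIV. laplacian E $ j $ k) = 0"
proof -
  have "laplacian E $ j $ k = (laplacian E *v axis k 1) $ j" for j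
    by (simp add: matrix_vector_mult_basis column_def)
  then show ?thesis
    by (simp add: laplacian_mult_vec[OF assms] sum_net_outflow[OF is_susceptance_adjacency[OF assms]])
qed

text \<open>Adding all other rows of \<open>x I - L\<close> to the row \<open>i\<close> turns that row into \<open>x (1, \<dots>, 1)\<close>;
  the remaining factor does not vanish at \<open>0\<close> because the graph is connected.\<close>

lemma char_polynomial_laplacian_factor:
  fixes E :: "('v::finite \<times> 'v) set"
  assumes E: "connected_simple_graph E"
  shows "\<exists>Q. char_polynomial (laplacian E) = [:0, 1:] * Q \<and> poly Q 0 \<noteq> 0"
proof -
  fix i :: 'v
  let ?L = "laplacian E"
  define C :: "real \<Rightarrow> real^'v^'v"
    where "C = (\<lambda>x. \<chi> j. if j = i then vec 1 else (x *\<^sub>R mat 1 - ?L) $ j)"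
  define Q where "Q = det (\<chi> j l. if j = i then 1
      else (if j = l then [:0, 1:] else 0) - [:?L $ j $ l:])"
  have Q: "poly Q x = det (C x)" for x
    unfolding Q_def poly_det
    by (rule arg_cong[where f = det]) (auto simp: vec_eq_iff C_def mat_def)
  have "poly (char_polynomial ?L) x = x * det (C x)" for x
  proof -
    let ?A = "x *\<^sub>R mat 1 - ?L"
    define r where "r = (\<Sum>j\<in>UNIV - {i}. row j ?A)"
    have "r \<in> vec.span {row j ?A |j. j \<noteq> i}"
      unfolding r_def by (intro vec.span_sum vec.span_base) auto
    then have "det ?A = det (\<chi> j. if j = i then row i ?A + r else row j ?A)"
      by (rule det_row_span[symmetric])
    also have "row i ?A + r = (\<Sum>j\<in>UNIV. row j ?A)"
      unfolding r_def by (simp add: sum.remove[of UNIV i])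
    also have "\<dots> = x *s vec 1"
    proof -
      \<comment> \<open>The columns of the Laplacian sum to zero, so only the diagonal
        \<open>x\<close> survives.\<close>
      have "(\<Sum>j\<in>UNIV. ?A $ j $ l) = x" for l
        using laplacian_col_sum[OF E, of l]
        by (simp add: sum_subtractf mat_def flip: sum_distrib_left)
      then show ?thesis
        by (simp add: vec_eq_iff row_def)
    qed
    also have "det (\<chi> j. if j = i then x *s vec 1 else row j ?A)
        = x * det (\<chi> j. if j = i then vec 1 else row j ?A)"
      by (rule det_row_mul)
    also have "(\<chi> j. if j = i then vec 1 else row j ?A) = C x"
      by (simp add: C_def vec_eq_iff row_def)
    finally show ?thesis
      by (simp add: poly_char_polynomial)
  qed
  then have "poly (char_polynomial ?L) = poly ([:0, 1:] * Q)"
    by (auto simp: Q)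
  then have 1: "char_polynomial ?L = [:0, 1:] * Q"
    using poly_eq_poly_eq_iff by blast
  \<comment> \<open>For a null vector of \<open>C 0\<close>, row \<open>i\<close> gives sum zero and
    the other rows make \<open>?L *v v\<close> vanish off \<open>i\<close>; since the entries of
    \<open>?L *v v\<close> sum to zero, it vanishes at \<open>i\<close> too.\<close>
  have "v = 0" if v: "C 0 *v v = 0" for v
  proof -
    have Cv: "(C 0 *v v) $ j = (if j = i then \<Sum>l\<in>UNIV. v $ l else - ((?L *v v) $ j))" for j
      by (simp add: C_def matrix_vector_mult_def sum_negf)
    have Lv: "(?L *v v) $ j = 0" if "j \<noteq> i" for j
      using v Cv[of j] that by simp
    have "(\<Sum>j\<in>UNIV. (?L *v v) $ j) = 0"
      by (simp add: laplacian_mult_vec[OF E] sum_net_outflow[OF is_susceptance_adjacency[OF E]])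
    moreover have "(\<Sum>j\<in>UNIV. (?L *v v) $ j) = (?L *v v) $ i"
      using Lv by (simp add: sum.remove[of UNIV i])
    ultimately have "(?L *v v) $ j = 0" for j
      using Lv by (cases "j = i") auto
    moreover have "(\<Sum>l\<in>UNIV. v $ l) = 0"
      using v Cv[of i] by simp
    ultimately have "v $ j = 0" for j
      using net_outflow_eq_0_imp_eq_0[OF is_susceptance_adjacency[OF E] E, of "($) v" j]
      by (simp add: laplacian_mult_vec[OF E])
    then show ?thesis
      by (simp add: vec_eq_iff)
  qed
  then have "poly Q 0 \<noteq> 0"
    unfolding Q det_eq_0_iff_ker by blast
  with 1 show ?thesis
    by blast
qed

section \<open>The second entry of a sorted multiset\<close>

text \<open>In the sorted list \<open>a\<close> must precede \<open>b\<close>, so \<open>b\<close>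
  sits at index 1 or later; the size claim makes index 1 legitimate.\<close>

lemma sorted_list_of_multiset_nth_1_le:
  fixes a b :: "'a::linorder"
  assumes "a \<in># M" "b \<in># M" "a < b"
  shows "1 < size M" "sorted_list_of_multiset M ! 1 \<le> b"
proof -
  let ?l = "sorted_list_of_multiset M"
  obtain i j where ij: "i < length ?l" "?l ! i = a" "j < length ?l" "?l ! j = b"
    using assms(1,2) by (metis in_set_conv_nth set_sorted_list_of_multiset)
  have "i < j"
    using ij assms(3) by (metis leD leI sorted_nth_mono sorted_sorted_list_of_multiset)
  moreover have "length ?l = size M"
    by (metis mset_sorted_list_of_multiset size_mset)
  ultimately show "1 < size M" "?l ! 1 \<le> b"
    using ij sorted_nth_mono[OF sorted_sorted_list_of_multiset[of M], of 1 j] by auto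
qed

text \<open>The first two entries are at least \<open>a\<close>, and multiplicity at most one keeps
  them from both being equal to \<open>a\<close>.\<close>

lemma sorted_list_of_multiset_nth_1_gt:
  fixes a :: "'a::linorder"
  assumes "\<And>x. x \<in># M \<Longrightarrow> a \<le> x" "count M a \<le> 1" "1 < size M"
  shows "a < sorted_list_of_multiset M ! 1"
proof -
  let ?l = "sorted_list_of_multiset M"
  have len: "length ?l = size M"
    by (metis mset_sorted_list_of_multiset size_mset)
  then obtain x y zs where l: "?l = x # y # zs"
    using assms(3) by (metis Suc_le_length_iff Suc_leI One_nat_def)
  have M: "M = mset (x # y # zs)"
    by (metis l mset_sorted_list_of_multiset)
  have "x \<le> y"
    using l sorted_sorted_list_of_multiset[of M] by simp
  moreover have "a \<le> x"
    using M by (intro assms(1)) simp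
  moreover have "x \<noteq> a \<or> y \<noteq> a"
    using assms(2) M by auto
  ultimately show ?thesis
    by (auto simp: l)
qed

text \<open>A minimiser of the Rayleigh quotient on the vectors of sum zero is an eigenvector.\<close>

lemma laplacian_rayleigh:
  fixes E :: "('v::finite \<times> 'v) set"
  assumes n: "CARD('v) \<ge> 2" and E: "connected_simple_graph E"
  obtains \<mu> v where "v \<noteq> 0" "laplacian E *v v = \<mu> *\<^sub>R v" "(\<Sum>j\<in>UNIV. v $ j) = 0"
    "\<And>x. (\<Sum>j\<in>UNIV. x $ j) = 0 \<Longrightarrow> \<mu> * (x \<bullet> x) \<le> x \<bullet> (laplacian E *v x)"
proof -
  let ?L = "laplacian E"
  note A = is_susceptance_adjacency[OF E]
  let ?H = "{x::real^'v. x \<bullet> vec 1 = 0}"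
  have H: "x \<in> ?H \<longleftrightarrow> (\<Sum>j\<in>UNIV. x $ j) = 0" for x
    by (simp add: inner_vec_def)
  have sym: "x \<bullet> (?L *v y) = y \<bullet> (?L *v x)" for x y
    using sum_mult_net_outflow_commute[OF A, of "($) x" "($) y"]
    by (simp add: inner_vec_def laplacian_mult_vec[OF E])
  let ?S = "sphere 0 1 \<inter> ?H"
  obtain i j :: 'v where "i \<noteq> j"
    using n card_le_Suc0_iff_eq[of "UNIV :: 'v set"] by fastforce
  \<comment> \<open>Two distinct buses yield a nonzero vector of sum zero, so the set
    \<open>?S\<close> on which the minimum is sought is nonempty.\<close>
  define e :: "real^'v" where "e = axis i 1 - axis j 1"
  have "e $ i = 1"
    using \<open>i \<noteq> j\<close> by (simp add: e_def axis_def)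
  then have "e \<noteq> 0"
    by auto
  moreover have "e \<in> ?H"
    by (simp add: e_def inner_diff_left inner_axis')
  ultimately have "(1 / norm e) *\<^sub>R e \<in> ?S"
    by simp
  then have "?S \<noteq> {}"
    by blast
  moreover have "compact ?S"
    by (intro compact_Int_closed compact_sphere closed_Collect_eq continuous_intros)
  moreover have "continuous_on ?S (\<lambda>x. x \<bullet> (?L *v x))"
    by (intro continuous_intros linear_continuous_on linear_linear[THEN iffD2] matrix_vector_mul_linear)
  ultimately obtain v where v: "v \<in> ?S" "\<And>x. x \<in> ?S \<Longrightarrow> v \<bullet> (?L *v v) \<le> x \<bullet> (?L *v x)"
    using continuous_attains_inf[of ?S "\<lambda>x. x \<bullet> (?L *v x)"] by blast
  define \<mu> where "\<mu> = v \<bullet> (?L *v v)"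
  have vv: "v \<bullet> v = 1"
    using v(1) by (simp add: norm_eq_1)
  have min: "\<mu> * (x \<bullet> x) \<le> x \<bullet> (?L *v x)" if x: "x \<in> ?H" for x
  proof (cases "x = 0")
    case False
    let ?y = "(1 / norm x) *\<^sub>R x"
    have "?y \<in> ?S"
      using False x by simp
    then have "\<mu> \<le> ?y \<bullet> (?L *v ?y)"
      unfolding \<mu>_def by (rule v(2))
    also have "\<dots> = (x \<bullet> (?L *v x)) / (x \<bullet> x)"
      by (simp add: matrix_vector_mult_scaleR dot_square_norm power2_eq_square)
    finally show ?thesis
      using False by (simp add: pos_le_divide_eq)
  qed simp
  \<comment> \<open>The residual of the eigenvalue equation. It has sum zero, so \<open>v\<close>
    may be perturbed along \<open>w\<close> without leaving \<open>?H\<close>.\<close>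
  define w where "w = ?L *v v - \<mu> *\<^sub>R v"
  have v_sum: "(\<Sum>j\<in>UNIV. v $ j) = 0"
    using v(1) H by blast
  have "w \<in> ?H"
    unfolding H using v_sum sum_net_outflow[OF A, of "($) v"]
    by (simp add: w_def sum_subtractf laplacian_mult_vec[OF E] flip: sum_distrib_left)
  \<comment> \<open>Minimality tested at \<open>v + t *\<^sub>R w\<close>: by the choice of
    \<open>w\<close>, the first-order coefficient is exactly twice
    \<open>w \<bullet> w\<close>.\<close>
  have quad: "0 \<le> 2 * t * (w \<bullet> w) + t\<^sup>2 * (w \<bullet> (?L *v w) - \<mu> * (w \<bullet> w))" for t
  proof -
    have "v + t *\<^sub>R w \<in> ?H"
      using v(1) \<open>w \<in> ?H\<close> by (simp add: inner_add_left)
    from min[OF this] have 1: "\<mu> * ((v + t *\<^sub>R w) \<bullet> (v + t *\<^sub>R w))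
        \<le> (v + t *\<^sub>R w) \<bullet> (?L *v (v + t *\<^sub>R w))" .
    have 2: "(v + t *\<^sub>R w) \<bullet> (?L *v (v + t *\<^sub>R w))
        = \<mu> + 2 * t * (w \<bullet> (?L *v v)) + t\<^sup>2 * (w \<bullet> (?L *v w))"
      using sym[of v w] by (simp add: \<mu>_def matrix_vector_right_distrib matrix_vector_mult_scaleR
          inner_add_left inner_add_right power2_eq_square algebra_simps)
    have 3: "(v + t *\<^sub>R w) \<bullet> (v + t *\<^sub>R w) = 1 + 2 * t * (w \<bullet> v) + t\<^sup>2 * (w \<bullet> w)"
      using inner_commute[of v w] vv
      by (simp add: inner_add_left inner_add_right power2_eq_square algebra_simps)
    have 4: "w \<bullet> (?L *v v) = w \<bullet> w + \<mu> * (w \<bullet> v)"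
      by (subst (3) w_def) (simp add: inner_diff_right)
    show ?thesis
      using 1 unfolding 2 3 4 by (simp add: algebra_simps)
  qed
  have "w \<bullet> w \<le> 0"
  proof (rule ccontr)
    assume pos: "\<not> w \<bullet> w \<le> 0"
    define c where "c = w \<bullet> (?L *v w) - \<mu> * (w \<bullet> w)"
    \<comment> \<open>Negative, and so small that \<open>t * c\<close> cannot offset more than half
      of \<open>2 * (w \<bullet> w)\<close>; the \<open>1 +\<close> avoids division by zero.\<close>
    define t where "t = - (w \<bullet> w) / (1 + \<bar>c\<bar>)"
    have "t < 0"
      unfolding t_def using pos by (intro divide_neg_pos) auto
    have "0 \<le> t * (2 * (w \<bullet> w) + t * c)"
      using quad[of t] by (simp add: c_def power2_eq_square algebra_simps)
    then have "2 * (w \<bullet> w) + t * c \<le> 0"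
      using \<open>t < 0\<close> by (simp add: zero_le_mult_iff)
    moreover have "- (t * c) \<le> w \<bullet> w"
    proof -
      have "- (t * c) = (w \<bullet> w) * (c / (1 + \<bar>c\<bar>))"
        by (simp add: t_def)
      also have "\<dots> \<le> (w \<bullet> w) * 1"
        using pos by (intro mult_left_mono) (auto simp: divide_le_eq)
      finally show ?thesis
        by simp
    qed
    ultimately show False
      using pos by linarith
  qed
  then have "w = 0"
    by (metis inner_gt_zero_iff not_le)
  then have "?L *v v = \<mu> *\<^sub>R v"
    by (simp add: w_def)
  moreover have "v \<noteq> 0"
    using vv by auto
  ultimately show thesis
    using that[of v \<mu>] min H v_sum by blast
qed

section \<open>Spectral bounds on the energy\<close>

text \<open>All eigenvalues are nonnegative and 0 is simple, so the second one is positive. The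
  Rayleigh minimum \<open>\<mu>\<close> is an eigenvalue above 0, hence at least the second one, and
  its energy bound passes down to that smaller value.\<close>

lemma algebraic_connectivity_bounds:
  fixes E :: "('v::finite \<times> 'v) set"
  assumes n: "CARD('v) \<ge> 2" and E: "connected_simple_graph E"
  shows "algebraic_connectivity E > 0"
    and "(\<Sum>j\<in>UNIV. y j) = 0 \<Longrightarrow> algebraic_connectivity E * (\<Sum>j\<in>UNIV. (y j)\<^sup>2)
      \<le> (\<Sum>j\<in>UNIV. y j * net_outflow (adjacency E) y j)"
proof -
  let ?L = "laplacian E" and ?P = "char_polynomial (laplacian E)"
  note A = is_susceptance_adjacency[OF E]
  obtain Q where Q: "?P = [:0, 1:] * Q" "poly Q 0 \<noteq> 0"
    using char_polynomial_laplacian_factor[OF E] by blast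
  then have P0: "?P \<noteq> 0"
    by auto
  have energy: "x \<bullet> (?L *v x) = (\<Sum>j\<in>UNIV. x $ j * net_outflow (adjacency E) (($) x) j)" for x
    by (simp add: inner_vec_def laplacian_mult_vec[OF E])
  have root: "x \<in># proots ?P \<longleftrightarrow> (\<exists>v. v \<noteq> 0 \<and> ?L *v v = x *\<^sub>R v)" for x
    using P0 by (simp add: char_polynomial_root_iff)
  have nonneg: "0 \<le> x" if x: "x \<in># proots ?P" for x
  proof -
    obtain v where v: "v \<noteq> 0" "?L *v v = x *\<^sub>R v"
      using iffD1[OF root x] by blast
    have "0 \<le> v \<bullet> (?L *v v)"
      unfolding energy by (rule energy_nonneg[OF A])
    then have "0 \<le> x * (v \<bullet> v)"
      by (simp add: v(2))
    moreover have "v \<bullet> v > 0"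
      using v(1) by simp
    ultimately show ?thesis
      by (simp add: zero_le_mult_iff)
  qed
  \<comment> \<open>The cofactor \<open>Q\<close> is nonzero at 0, so the root 0 has multiplicity
    one.\<close>
  have "order 0 ?P = order 0 [:0, 1::real:] + order 0 Q"
    using P0 unfolding Q(1) by (rule order_mult)
  also have "order 0 Q = 0"
    using Q(2) by (simp add: order_0I)
  also have "order 0 [:0, 1::real:] = 1"
    using order_power_n_n[of "0::real" 1] by simp
  finally have count: "count (proots ?P) 0 \<le> 1"
    using P0 by (simp add: count_proots)
  obtain \<mu> v where v: "v \<noteq> 0" "?L *v v = \<mu> *\<^sub>R v" "(\<Sum>j\<in>UNIV. v $ j) = 0"
    and min: "\<And>x. (\<Sum>j\<in>UNIV. x $ j) = 0 \<Longrightarrow> \<mu> * (x \<bullet> x) \<le> x \<bullet> (?L *v x)"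
    using laplacian_rayleigh[OF n E] by blast
  have zero: "0 \<in># proots ?P"
    using P0 Q(1) by simp
  have \<mu>: "\<mu> \<in># proots ?P"
    unfolding root using v(1,2) by (intro exI conjI)
  have "\<mu> \<noteq> 0"
  proof
    assume "\<mu> = 0"
    then have "net_outflow (adjacency E) (($) v) j = 0" for j
      using v(2) laplacian_mult_vec[OF E, of v j] by simp
    then have "v $ j = 0" for j
      using net_outflow_eq_0_imp_eq_0[OF A E _ v(3)] by blast
    then show False
      using v(1) by (simp add: vec_eq_iff)
  qed
  then have "0 < \<mu>"
    using nonneg[OF \<mu>] by simp
  note second = sorted_list_of_multiset_nth_1_le[OF zero \<mu> this]
  show "algebraic_connectivity E > 0"
    unfolding algebraic_connectivity_def eigenvalue_list_def
    using nonneg count second(1) by (rule sorted_list_of_multiset_nth_1_gt)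
  assume y: "(\<Sum>j\<in>UNIV. y j) = 0"
  have "algebraic_connectivity E * (\<Sum>j\<in>UNIV. (y j)\<^sup>2) \<le> \<mu> * (\<Sum>j\<in>UNIV. (y j)\<^sup>2)"
    using second(2) unfolding algebraic_connectivity_def eigenvalue_list_def
    by (intro mult_right_mono sum_nonneg) auto
  also have "\<dots> \<le> (\<Sum>j\<in>UNIV. y j * net_outflow (adjacency E) y j)"
    using min[of "\<chi> j. y j", unfolded energy] y
    by (simp add: inner_vec_def power2_eq_square net_outflow_def)
  finally show "algebraic_connectivity E * (\<Sum>j\<in>UNIV. (y j)\<^sup>2)
      \<le> (\<Sum>j\<in>UNIV. y j * net_outflow (adjacency E) y j)" .
qed

text \<open>A path between two distinct buses provides a line, so the minimum ranges over a nonempty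
  set of positive numbers. Off the lines both sides of the second bound are 0.\<close>

lemma min_susceptance_bounds:
  fixes E :: "('v::finite \<times> 'v) set"
  assumes n: "CARD('v) \<ge> 2" and E: "connected_simple_graph E" and B: "is_susceptance E B"
  shows "min_susceptance E B > 0"
    and "min_susceptance E B * adjacency E j k \<le> B j k"
proof -
  obtain v w :: 'v where "v \<noteq> w"
    using n card_le_Suc0_iff_eq[of "UNIV :: 'v set"] by fastforce
  moreover have "(v, w) \<in> E\<^sup>*"
    using E by (simp add: connected_simple_graph_def)
  ultimately have "E \<noteq> {}"
    by auto
  then show "min_susceptance E B > 0"
    using B by (auto simp: min_susceptance_def is_susceptance_def)
  show "min_susceptance E B * adjacency E j k \<le> B j k"
  proof (cases "(j, k) \<in> E")
    case True
    then have "B j k \<in> (\<lambda>(j, k). B j k) ` E"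
      by force
    then show ?thesis
      using True by (simp add: min_susceptance_def adjacency_def)
  qed (use B in \<open>simp add: adjacency_def is_susceptance_def\<close>)
qed

text \<open>The energy is monotone in the susceptances, so replacing each by
  \<open>min_susceptance E B\<close> on the lines reduces the claim to the unweighted spectral
  bound.\<close>

lemma energy_lower_bound:
  fixes E :: "('v::finite \<times> 'v) set"
  assumes n: "CARD('v) \<ge> 2" and E: "connected_simple_graph E" and B: "is_susceptance E B"
    and y: "(\<Sum>j\<in>UNIV. y j) = 0"
  shows "min_susceptance E B * algebraic_connectivity E * (\<Sum>j\<in>UNIV. (y j)\<^sup>2)
    \<le> (\<Sum>j\<in>UNIV. y j * net_outflow B y j)"
proof -
  let ?b = "min_susceptance E B" and ?A = "adjacency E"
  have "?b * (\<Sum>j\<in>UNIV. \<Sum>k\<in>UNIV. ?A j k * ((y j - y k) * (y j - y k)))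
      = (\<Sum>j\<in>UNIV. \<Sum>k\<in>UNIV. (?b * ?A j k) * ((y j - y k) * (y j - y k)))"
    by (simp add: sum_distrib_left mult.assoc)
  also have "\<dots> \<le> (\<Sum>j\<in>UNIV. \<Sum>k\<in>UNIV. B j k * ((y j - y k) * (y j - y k)))"
    using min_susceptance_bounds(2)[OF n E B] by (intro sum_mono mult_right_mono) auto
  finally have "?b * (2 * (\<Sum>j\<in>UNIV. y j * net_outflow ?A y j))
      \<le> 2 * (\<Sum>j\<in>UNIV. y j * net_outflow B y j)"
    unfolding sum_mult_net_outflow[OF B] sum_mult_net_outflow[OF is_susceptance_adjacency[OF E]] .
  then have "?b * (\<Sum>j\<in>UNIV. y j * net_outflow ?A y j) \<le> (\<Sum>j\<in>UNIV. y j * net_outflow B y j)"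
    by simp
  moreover have "?b * (algebraic_connectivity E * (\<Sum>j\<in>UNIV. (y j)\<^sup>2))
      \<le> ?b * (\<Sum>j\<in>UNIV. y j * net_outflow ?A y j)"
    using algebraic_connectivity_bounds(2)[OF n E y] min_susceptance_bounds(1)[OF n E B]
    by (intro mult_left_mono) auto
  ultimately show ?thesis
    by (simp add: mult.assoc)
qed

section \<open>Economic dispatch\<close>

text \<open>Pythagoras: \<open>c / a j\<close> has the same total as \<open>u\<close> and equal
  marginal cost \<open>c\<close> at every bus, so the cross term is \<open>c\<close> times a
  deviation of sum zero.\<close>

lemma cost_eq_deviation:
  fixes a :: "'v::finite \<Rightarrow> real"
  assumes a: "\<forall>j. a j > 0" and u: "(\<Sum>j\<in>UNIV. u j) = - s"
  defines "c \<equiv> - s / (\<Sum>j\<in>UNIV. 1 / a j)"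
  shows "cost a u = cost a (\<lambda>j. c / a j) + cost a (\<lambda>j. u j - c / a j)"
proof -
  let ?A = "\<Sum>j\<in>UNIV. 1 / a j"
  have "?A > 0"
    using a by (intro sum_pos) auto
  have "(\<Sum>j\<in>UNIV. c * (u j - c / a j)) = c * (- s - c * ?A)"
    by (simp add: sum_subtractf u sum_distrib_left right_diff_distrib flip: u)
  also have "\<dots> = 0"
    using \<open>?A > 0\<close> by (simp add: c_def)
  finally have 0: "(\<Sum>j\<in>UNIV. c * (u j - c / a j)) = 0" .
  have "1 / 2 * a j * (u j)\<^sup>2 = 1 / 2 * a j * (c / a j)\<^sup>2 + 1 / 2 * a j * (u j - c / a j)\<^sup>2
      + c * (u j - c / a j)" for j
    using a[rule_format, of j] by (simp add: power2_eq_square field_simps)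
  then have "cost a u = cost a (\<lambda>j. c / a j) + cost a (\<lambda>j. u j - c / a j)
      + (\<Sum>j\<in>UNIV. c * (u j - c / a j))"
    unfolding cost_def sum.distrib[symmetric] by (intro sum.cong refl)
  then show ?thesis
    using 0 by simp
qed

text \<open>Balance forces every feasible control to sum to \<open>- s\<close>, so the decomposition
  gives the lower bound. It is attained because \<open>p j + c / a j\<close> has sum zero and is
  therefore the outflow of some angles.\<close>

lemma optimal_cost_eq:
  fixes a :: "'v::finite \<Rightarrow> real"
  assumes a: "\<forall>j. a j > 0" and B: "is_susceptance E B" and E: "connected_simple_graph E"
    and p: "(\<Sum>j\<in>UNIV. p j) = s"
  defines "c \<equiv> - s / (\<Sum>j\<in>UNIV. 1 / a j)"
  shows "optimal_cost a B p = cost a (\<lambda>j. c / a j)"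
  unfolding optimal_cost_def
proof (rule Least_equality)
  have "(\<Sum>j\<in>UNIV. 1 / a j) > 0"
    using a by (intro sum_pos) auto
  then have "c * (\<Sum>j\<in>UNIV. 1 / a j) = - s"
    by (simp add: c_def)
  then have "(\<Sum>j\<in>UNIV. p j + c / a j) = 0"
    by (simp add: sum.distrib p sum_distrib_left)
  then obtain \<theta> where "\<forall>j. net_outflow B \<theta> j = p j + c / a j"
    using net_outflow_surj[OF B E] by blast
  then have "(\<lambda>j. c / a j, \<theta>) \<in> dispatch_feasible B p"
    by (simp add: dispatch_feasible_def)
  then show "cost a (\<lambda>j. c / a j) \<in> (\<lambda>(u, \<theta>). cost a u) ` dispatch_feasible B p"
    by force
next
  fix y assume "y \<in> (\<lambda>(u, \<theta>). cost a u) ` dispatch_feasible B p"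
  then obtain u \<theta> where y: "y = cost a u" and f: "\<And>j. u j = net_outflow B \<theta> j - p j"
    unfolding dispatch_feasible_def by (force simp: algebra_simps)
  have "(\<Sum>j\<in>UNIV. u j) = - s"
    by (simp add: f sum_subtractf sum_net_outflow[OF B] p)
  from cost_eq_deviation[OF a this] have "y = cost a (\<lambda>j. c / a j) + cost a (\<lambda>j. u j - c / a j)"
    by (simp add: y c_def)
  moreover have "cost a (\<lambda>j. u j - c / a j) \<ge> 0"
    unfolding cost_def using a by (intro sum_nonneg mult_nonneg_nonneg) (auto intro: less_imp_le)
  ultimately show "cost a (\<lambda>j. c / a j) \<le> y"
    by simp
qed

section \<open>The steady state\<close>

text \<open>From some time on \<open>f t - c * t\<close> is nondecreasing, so \<open>f\<close> stays
  above a line of slope \<open>c\<close>.\<close>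

lemma filterlim_at_top_of_derivative_ge:
  fixes f f' :: "real \<Rightarrow> real"
  assumes f: "\<And>t. t \<ge> 0 \<Longrightarrow> (f has_real_derivative f' t) (at t within {0..})"
    and c: "c > 0" and ev: "eventually (\<lambda>t. f' t \<ge> c) at_top"
  shows "filterlim f at_top at_top"
proof -
  obtain T0 where T0: "\<And>t. t \<ge> T0 \<Longrightarrow> f' t \<ge> c"
    using ev by (auto simp: eventually_at_top_linorder)
  \<comment> \<open>The maximum with 0 makes all later times interior to \<open>{0..}\<close>, where
    the derivative is two-sided.\<close>
  define T where "T = max T0 0"
  have "T \<ge> 0"
    by (simp add: T_def)
  have ge: "f T + c * (t - T) \<le> f t" if "t \<ge> T" for t
  proof -
    have "f T - c * T \<le> f t - c * t"
    proof (rule DERIV_nonneg_imp_increasing_open[OF that])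
      show "continuous_on {T..t} (\<lambda>t. f t - c * t)"
      proof (intro continuous_intros)
        have "continuous_on {0..} f"
          using f by (intro DERIV_continuous_on) auto
        then show "continuous_on {T..t} f"
          by (rule continuous_on_subset) (use \<open>T \<ge> 0\<close> in auto)
      qed
      fix x assume x: "T < x" "x < t"
      then have "x \<in> interior {0..}"
        using \<open>T \<ge> 0\<close> by simp
      then have "(f has_real_derivative f' x) (at x)"
        using f[of x] x \<open>T \<ge> 0\<close> by (simp add: at_within_interior[OF \<open>x \<in> interior {0..}\<close>])
      then have "((\<lambda>t. f t - c * t) has_real_derivative f' x - c) (at x)"
        by (auto intro!: derivative_eq_intros)
      moreover have "f' x - c \<ge> 0"
        using T0[of x] x by (simp add: T_def)
      ultimately show "\<exists>y. ((\<lambda>t. f t - c * t) has_real_derivative y) (at x) \<and> 0 \<le> y"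
        by blast
    qed
    then show ?thesis
      by (simp add: algebra_simps)
  qed
  have "filterlim (\<lambda>t. (f T - c * T) + c * t) at_top at_top"
    using c by (intro filterlim_tendsto_add_at_top[OF tendsto_const]
        filterlim_tendsto_pos_mult_at_top[OF tendsto_const] filterlim_ident)
  moreover have "eventually (\<lambda>t. (f T - c * T) + c * t \<le> f t) at_top"
    using eventually_ge_at_top[of T]
  proof eventually_elim
    case (elim t)
    then show ?case
      using ge[of t] by (simp add: right_diff_distrib)
  qed
  ultimately show ?thesis
    by (rule filterlim_at_top_mono)
qed

text \<open>Both bus types are covered: \<open>m = 0\<close> at a load bus.  A positive limit of the power imbalance
  \<open>g\<close> would drive \<open>m \<omega> + d \<theta>\<close>, hence \<open>\<omega>\<close>, hence \<open>\<theta>\<close>, to infinity.\<close>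

lemma imbalance_limit_nonpos:
  fixes \<theta> \<omega> g :: "real \<Rightarrow> real"
  assumes \<theta>: "\<And>t. t \<ge> 0 \<Longrightarrow> (\<theta> has_real_derivative \<omega> t) (at t within {0..})"
    and \<omega>: "\<And>t. t \<ge> 0 \<Longrightarrow> m > 0 \<Longrightarrow>
      \<exists>\<omega>'. (\<omega> has_real_derivative \<omega>') (at t within {0..}) \<and> m * \<omega>' = - d * \<omega> t + g t"
    and load: "\<And>t. t \<ge> 0 \<Longrightarrow> m = 0 \<Longrightarrow> d * \<omega> t = g t"
    and m: "m \<ge> 0" and d: "d > 0"
    and lim: "(\<theta> \<longlongrightarrow> l) at_top" "(g \<longlongrightarrow> c) at_top"
  shows "c \<le> 0"
proof (rule ccontr)
  assume "\<not> c \<le> 0"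
  then have "eventually (\<lambda>t. g t > c / 2) at_top"
    using lim(2) by (intro order_tendstoD(1)) auto
  then have g: "eventually (\<lambda>t. g t \<ge> c / 2) at_top"
    by (rule eventually_mono) simp
  have "\<exists>e>0. eventually (\<lambda>t. \<omega> t \<ge> e) at_top"
  proof (cases "m = 0")
    case True
    have "eventually (\<lambda>t. \<omega> t \<ge> c / 2 / d) at_top"
      using g eventually_ge_at_top[of 0]
    proof eventually_elim
      case (elim t)
      then show ?case
        unfolding pos_divide_le_eq[OF d] using load[OF elim(2) True] by (simp add: mult.commute)
    qed
    then show ?thesis
      using \<open>\<not> c \<le> 0\<close> d by (intro exI[of _ "c / 2 / d"]) auto
  next
    case False
    then have m: "m > 0"
      using m by simp
    have "((\<lambda>t. m * \<omega> t + d * \<theta> t) has_real_derivative g t) (at t within {0..})" if t: "t \<ge> 0" for t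
    proof -
      obtain \<omega>' where \<omega>': "(\<omega> has_real_derivative \<omega>') (at t within {0..})"
          "m * \<omega>' = - d * \<omega> t + g t"
        using \<omega>[OF t m] by blast
      have "((\<lambda>t. m * \<omega> t + d * \<theta> t) has_real_derivative m * \<omega>' + d * \<omega> t) (at t within {0..})"
        using \<omega>'(1) \<theta>[OF t] by (auto intro!: derivative_eq_intros)
      then show ?thesis
        using \<omega>'(2) by simp
    qed
    then have "filterlim (\<lambda>t. m * \<omega> t + d * \<theta> t) at_top at_top"
      by (rule filterlim_at_top_of_derivative_ge[where c = "c / 2"]) (use \<open>\<not> c \<le> 0\<close> g in auto)
    \<comment> \<open>The threshold is chosen so that \<open>\<theta> t < l + 1\<close> leaves
      \<open>m * \<omega> t \<ge> m\<close>, that is, \<open>\<omega> t \<ge> 1\<close>.\<close>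
    then have 1: "eventually (\<lambda>t. m * \<omega> t + d * \<theta> t \<ge> d * (l + 1) + m) at_top"
      by (simp add: filterlim_at_top)
    have 2: "eventually (\<lambda>t. \<theta> t < l + 1) at_top"
      using lim(1) by (intro order_tendstoD(2)) auto
    have "eventually (\<lambda>t. \<omega> t \<ge> 1) at_top"
      using 1 2
    proof eventually_elim
      case (elim t)
      have "d * \<theta> t \<le> d * (l + 1)"
        using elim(2) d by (intro mult_left_mono) auto
      then have "m * 1 \<le> m * \<omega> t"
        using elim(1) by simp
      then show ?case
        using m by (metis mult_le_cancel_left_pos)
    qed
    then show ?thesis
      by (intro exI[of _ 1]) auto
  qed
  then obtain e where "e > 0" "eventually (\<lambda>t. \<omega> t \<ge> e) at_top"
    by blast
  with \<theta> have "filterlim \<theta> at_top at_top"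
    by (intro filterlim_at_top_of_derivative_ge)
  then have "eventually (\<lambda>t. \<theta> t \<ge> l + 1) at_top"
    by (simp add: filterlim_at_top)
  moreover have "eventually (\<lambda>t. \<theta> t < l + 1) at_top"
    using lim(1) by (intro order_tendstoD(2)) auto
  ultimately have "eventually (\<lambda>t::real. False) at_top"
    by eventually_elim simp
  then show False
    by simp
qed

text \<open>The hypotheses survive negating \<open>\<theta>\<close>, \<open>\<omega>\<close> and
  \<open>g\<close> together, so the one-sided bound applies to both \<open>c\<close> and
  \<open>- c\<close>.\<close>

lemma imbalance_limit_eq_0:
  fixes \<theta> \<omega> g :: "real \<Rightarrow> real"
  assumes \<theta>: "\<And>t. t \<ge> 0 \<Longrightarrow> (\<theta> has_real_derivative \<omega> t) (at t within {0..})"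
    and \<omega>: "\<And>t. t \<ge> 0 \<Longrightarrow> m > 0 \<Longrightarrow>
      \<exists>\<omega>'. (\<omega> has_real_derivative \<omega>') (at t within {0..}) \<and> m * \<omega>' = - d * \<omega> t + g t"
    and load: "\<And>t. t \<ge> 0 \<Longrightarrow> m = 0 \<Longrightarrow> d * \<omega> t = g t"
    and m: "m \<ge> 0" and d: "d > 0"
    and lim: "(\<theta> \<longlongrightarrow> l) at_top" "(g \<longlongrightarrow> c) at_top"
  shows "c = 0"
proof (rule antisym)
  show "c \<le> 0"
    by (rule imbalance_limit_nonpos[OF assms])
  have "- c \<le> 0"
  proof (rule imbalance_limit_nonpos[where \<theta> = "\<lambda>t. - \<theta> t" and \<omega> = "\<lambda>t. - \<omega> t"
        and g = "\<lambda>t. - g t" and m = m and d = d and l = "- l"])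
    fix t :: real assume t: "t \<ge> 0" and "m > 0"
    then obtain \<omega>' where "(\<omega> has_real_derivative \<omega>') (at t within {0..})"
        "m * \<omega>' = - d * \<omega> t + g t"
      using \<omega> by blast
    then show "\<exists>\<omega>'. ((\<lambda>t. - \<omega> t) has_real_derivative \<omega>') (at t within {0..})
        \<and> m * \<omega>' = - d * - \<omega> t + - g t"
      by (intro exI[of _ "- \<omega>'"]) (auto intro!: derivative_eq_intros)
  qed (use \<theta> load m d lim in \<open>auto intro!: derivative_eq_intros tendsto_minus\<close>)
  then show "0 \<le> c"
    by simp
qed

text \<open>Convergence of angles and controls makes the power imbalance at each bus converge, and
  its limit must be 0. The control law makes \<open>u t j + K j * \<theta> t j\<close> constant in
  time, so its initial value equals its limit.\<close>

lemma steady_state: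
  fixes B :: "'v::finite \<Rightarrow> 'v \<Rightarrow> real"
  assumes traj: "controlled_trajectory B VG M D K p \<theta>0 \<theta> \<omega> u"
    and settles: "settles_at \<theta> u \<theta>s us"
    and M: "\<forall>j\<in>VG. M j > 0" and D: "\<forall>j. D j > 0"
  shows "p j + us j = net_outflow B \<theta>s j" and "us j = - K j * (\<theta>s j - \<theta>0 j)"
proof -
  have \<theta>: "((\<lambda>s. \<theta> s j) has_real_derivative \<omega> t j) (at t within {0..})"
    and u: "((\<lambda>s. u s j) has_real_derivative - K j * \<omega> t j) (at t within {0..})"
    if "t \<ge> 0" for t j
    using traj that by (auto simp: controlled_trajectory_def)
  have \<theta>s: "((\<lambda>t. \<theta> t j) \<longlongrightarrow> \<theta>s j) at_top" and us: "((\<lambda>t. u t j) \<longlongrightarrow> us j) at_top" for j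
    using settles by (auto simp: settles_at_def)
  define g where "g = (\<lambda>t. p j + u t j - net_outflow B (\<theta> t) j)"
  have "(g \<longlongrightarrow> p j + us j - net_outflow B \<theta>s j) at_top"
    unfolding g_def net_outflow_def by (intro tendsto_intros \<theta>s us)
  then have "p j + us j - net_outflow B \<theta>s j = 0"
  proof (rule imbalance_limit_eq_0[where \<theta> = "\<lambda>t. \<theta> t j" and \<omega> = "\<lambda>t. \<omega> t j"
        and m = "if j \<in> VG then M j else 0" and d = "D j" and l = "\<theta>s j", rotated -1])
    show "\<exists>\<omega>'. ((\<lambda>t. \<omega> t j) has_real_derivative \<omega>') (at t within {0..})
        \<and> (if j \<in> VG then M j else 0) * \<omega>' = - D j * \<omega> t j + g t"
      if "t \<ge> 0" "0 < (if j \<in> VG then M j else 0)" for t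
      using traj that unfolding controlled_trajectory_def g_def
      by (auto split: if_splits simp: algebra_simps)
    show "D j * \<omega> t j = g t" if "t \<ge> 0" "(if j \<in> VG then M j else 0) = 0" for t
    proof -
      have "j \<in> - VG"
        using that(2) M by (auto split: if_splits)
      then have "0 = - D j * \<omega> t j + p j + u t j - net_outflow B (\<theta> t) j"
        using traj that(1) unfolding controlled_trajectory_def by blast
      then show ?thesis
        by (simp add: g_def)
    qed
  qed (use \<theta> \<theta>s M D in \<open>auto intro: less_imp_le\<close>)
  then show "p j + us j = net_outflow B \<theta>s j"
    by simp
  have "\<exists>c. \<forall>t\<in>{0..}. u t j + K j * \<theta> t j = c"
  proof (rule has_field_derivative_zero_constant)
    show "((\<lambda>t. u t j + K j * \<theta> t j) has_real_derivative 0) (at t within {0..})"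
      if "t \<in> {0..}" for t
      using u[of t j] \<theta>[of t j] that by (auto intro!: derivative_eq_intros)
  qed simp
  moreover have "\<theta> 0 j = \<theta>0 j" "u 0 j = 0"
    using traj by (auto simp: controlled_trajectory_def)
  ultimately have "u t j + K j * \<theta> t j = K j * \<theta>0 j" if "t \<ge> 0" for t
    using that by (metis add_0 atLeast_iff order_refl)
  then have "eventually (\<lambda>t. u t j + K j * \<theta> t j = K j * \<theta>0 j) at_top"
    using eventually_ge_at_top[of 0] by (rule eventually_mono[rotated])
  then have "((\<lambda>t. u t j + K j * \<theta> t j) \<longlongrightarrow> K j * \<theta>0 j) at_top"
    by (rule tendsto_eventually)
  moreover have "((\<lambda>t. u t j + K j * \<theta> t j) \<longlongrightarrow> us j + K j * \<theta>s j) at_top"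
    by (intro tendsto_intros \<theta>s us)
  ultimately have "us j + K j * \<theta>s j = K j * \<theta>0 j"
    using tendsto_unique trivial_limit_at_top_linorder by blast
  then show "us j = - K j * (\<theta>s j - \<theta>0 j)"
    by (simp add: algebra_simps)
qed

section \<open>The excess cost\<close>

text \<open>A zero weighted sum yields some \<open>j\<close> whose entry does not share the sign of
  a nonzero \<open>x k\<close>, so \<open>x k\<close> is no larger in size than
  \<open>x k - x j\<close>, a difference that centring at any \<open>m\<close> preserves.\<close>

lemma square_le_centered_norm:
  fixes x a :: "'v::finite \<Rightarrow> real"
  assumes a: "\<forall>j. a j > 0" and 0: "(\<Sum>j\<in>UNIV. x j / a j) = 0"
  shows "(x k)\<^sup>2 \<le> 2 * (\<Sum>j\<in>UNIV. (x j - m)\<^sup>2)"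
proof (cases "x k = 0")
  case True
  then show ?thesis
    by (simp add: sum_nonneg)
next
  case False
  have "\<exists>j. x k * x j \<le> 0"
  proof (rule ccontr)
    assume "\<not> ?thesis"
    then have "(\<Sum>j\<in>UNIV. x k * x j / a j) > 0"
      using a by (intro sum_pos) (auto simp: not_le)
    moreover have "(\<Sum>j\<in>UNIV. x k * x j / a j) = x k * (\<Sum>j\<in>UNIV. x j / a j)"
      by (simp add: sum_distrib_left)
    ultimately show False
      using 0 by simp
  qed
  then obtain j where j: "x k * x j \<le> 0"
    by blast
  then have "j \<noteq> k"
    using False by (metis mult_le_0_iff order_antisym linear)
  have "(x k)\<^sup>2 \<le> (x k - x j)\<^sup>2"
    using j zero_le_power2[of "x j"] unfolding power2_diff mult.assoc by linarith
  also have "\<dots> \<le> 2 * ((x k - m)\<^sup>2 + (x j - m)\<^sup>2)"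
    using zero_le_power2[of "(x k - m) + (x j - m)"] by (simp add: power2_eq_square algebra_simps)
  also have "(x k - m)\<^sup>2 + (x j - m)\<^sup>2 = (\<Sum>j\<in>{k, j}. (x j - m)\<^sup>2)"
    using \<open>j \<noteq> k\<close> by simp
  also have "2 * \<dots> \<le> 2 * (\<Sum>j\<in>UNIV. (x j - m)\<^sup>2)"
    by (intro mult_left_mono sum_mono2) auto
  finally show ?thesis .
qed

theorem theorem1:
  fixes E :: "('v::finite \<times> 'v) set"
    and B :: "'v \<Rightarrow> 'v \<Rightarrow> real"
    and VG :: "'v set"
    and M D a K p0 p \<theta>0 \<theta>s us :: "'v \<Rightarrow> real"
    and \<theta> \<omega> u :: "real \<Rightarrow> 'v \<Rightarrow> real"
    and h \<Delta>p :: real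
    and k :: 'v
  assumes "CARD('v) \<ge> 2"
    and "connected_simple_graph E"
    and "is_susceptance E B"
    and "\<forall>j\<in>VG. M j > 0" and "\<forall>j. D j > 0" and "\<forall>j. a j > 0"
    and "(\<Sum>j\<in>UNIV. p0 j) = 0"
    and "\<forall>j. p0 j = net_outflow B \<theta>0 j"
    and "p k = p0 k + \<Delta>p" and "\<forall>j. j \<noteq> k \<longrightarrow> p j = p0 j"
    and "h > 0" and "\<forall>j. K j = h / a j"
    and "controlled_trajectory B VG M D K p \<theta>0 \<theta> \<omega> u"
    and "settles_at \<theta> u \<theta>s us"
  shows "cost a us \<le> optimal_cost a B p
           + 4 * \<Delta>p\<^sup>2 * real CARD('v) * h / (min_susceptance E B * algebraic_connectivity E)"
proof -
  note n = assms(1) and E = assms(2) and B = assms(3) and a = assms(6) and h = assms(11)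
  define d where "d = (\<lambda>j. \<theta>s j - \<theta>0 j)"
  have p: "p j = p0 j + (if j = k then \<Delta>p else 0)" for j
    using assms(9,10) by auto
  have us: "us j = - (h / a j) * d j" for j
    using steady_state(2)[OF assms(13,14,4,5), of j] assms(12) by (simp add: d_def)
  \<comment> \<open>Subtracting the balance before the perturbation cancels \<open>p0\<close>,
    leaving the change at \<open>k\<close> and the control.\<close>
  have flow: "net_outflow B d j = (if j = k then \<Delta>p else 0) + us j" for j
    using steady_state(1)[OF assms(13,14,4,5), of j] p[of j] assms(8)
    by (simp add: d_def net_outflow_diff)
  have sum_p: "(\<Sum>j\<in>UNIV. p j) = \<Delta>p"
    using assms(7) by (simp add: p sum.distrib)
  have sum_us: "(\<Sum>j\<in>UNIV. us j) = - \<Delta>p"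
    using sum_net_outflow[OF B, of d] by (simp add: flow sum.distrib)
  define A where "A = (\<Sum>j\<in>UNIV. 1 / a j)"
  have "A > 0"
    unfolding A_def using a by (intro sum_pos) auto
  define c where "c = - \<Delta>p / A"
  \<comment> \<open>The shift by \<open>c / h\<close> makes the deviation of \<open>us\<close> from
    the optimal dispatch proportional to \<open>x j / a j\<close>; as \<open>us\<close> and the
    optimum both sum to \<open>- \<Delta>p\<close>, these terms sum to zero.\<close>
  define x where "x = (\<lambda>j. d j + c / h)"
  have dev: "us j - c / a j = - (h / a j) * x j" for j
    using h a[rule_format, of j] by (simp add: us x_def field_simps)
  have "c * A = - \<Delta>p"
    using \<open>A > 0\<close> by (simp add: c_def)
  then have "(\<Sum>j\<in>UNIV. us j - c / a j) = 0"
    by (simp add: sum_subtractf sum_us A_def sum_distrib_left)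
  moreover have "(\<Sum>j\<in>UNIV. us j - c / a j) = - h * (\<Sum>j\<in>UNIV. x j / a j)"
    by (simp add: dev sum_distrib_left sum_negf)
  ultimately have x0: "(\<Sum>j\<in>UNIV. x j / a j) = 0"
    using h by simp
  have x_flow: "net_outflow B x j = (if j = k then \<Delta>p else 0) - h * (x j / a j) + c / a j" for j
  proof -
    have "net_outflow B x j = net_outflow B d j"
      using net_outflow_diff_const[of B d "- (c / h)" j] by (simp add: x_def)
    then show ?thesis
      using dev[of j] by (simp add: flow algebra_simps)
  qed
  define S where "S = (\<Sum>j\<in>UNIV. (x j)\<^sup>2 / a j)"
  \<comment> \<open>The part \<open>c / a j\<close> of the flow is orthogonal to \<open>x\<close> by
    \<open>x0\<close>.\<close>
  have energy: "(\<Sum>j\<in>UNIV. x j * net_outflow B x j) = \<Delta>p * x k - h * S"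
  proof -
    have "x j * net_outflow B x j = (if j = k then \<Delta>p * x k else 0) - h * ((x j)\<^sup>2 / a j)
        + c * (x j / a j)" for j
      by (simp add: x_flow power2_eq_square algebra_simps)
    then have "(\<Sum>j\<in>UNIV. x j * net_outflow B x j) = \<Delta>p * x k - h * S + c * (\<Sum>j\<in>UNIV. x j / a j)"
      by (simp add: sum.distrib sum_subtractf S_def sum_distrib_left)
    then show ?thesis
      by (simp add: x0)
  qed
  \<comment> \<open>The spectral bound needs a vector of plain sum zero, while \<open>x\<close> only
    has weighted sum zero; hence this second centring.\<close>
  define m where "m = (\<Sum>j\<in>UNIV. x j) / real CARD('v)"
  define N where "N = (\<Sum>j\<in>UNIV. (x j - m)\<^sup>2)"
  define r where "r = min_susceptance E B * algebraic_connectivity E"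
  have "r > 0"
    unfolding r_def
    using min_susceptance_bounds(1)[OF n E B] algebraic_connectivity_bounds(1)[OF n E] by simp
  have "(\<Sum>j\<in>UNIV. x j - m) = 0"
    by (simp add: sum_subtractf m_def)
  from energy_lower_bound[OF n E B this]
  have "r * N \<le> (\<Sum>j\<in>UNIV. (x j - m) * net_outflow B x j)"
    by (simp add: r_def N_def net_outflow_diff_const)
  \<comment> \<open>The constant \<open>m\<close> pairs to zero with a flow.\<close>
  also have "\<dots> = \<Delta>p * x k - h * S"
    by (simp add: left_diff_distrib sum_subtractf energy sum_net_outflow[OF B] flip: sum_distrib_left)
  finally have S: "h * S \<le> \<Delta>p * x k - r * N"
    by simp
  have xk: "r * (x k)\<^sup>2 \<le> r * (2 * N)"
    unfolding N_def using \<open>r > 0\<close> square_le_centered_norm[OF a x0]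
    by (intro mult_left_mono) auto
  \<comment> \<open>Young's inequality with weight \<open>r\<close>: after \<open>xk\<close> and
    halving, its second term cancels exactly against \<open>r * N\<close> in
    \<open>S\<close>.\<close>
  have "2 * (\<Delta>p * x k) \<le> \<Delta>p\<^sup>2 / r + r * (x k)\<^sup>2"
  proof -
    have "0 \<le> (\<Delta>p - r * x k)\<^sup>2 / r"
      using \<open>r > 0\<close> by simp
    also have "\<dots> = \<Delta>p\<^sup>2 / r + r * (x k)\<^sup>2 - 2 * (\<Delta>p * x k)"
      using \<open>r > 0\<close> by (simp add: power2_eq_square field_simps)
    finally show ?thesis
      by simp
  qed
  with S xk have "h * S \<le> \<Delta>p\<^sup>2 / r / 2"
    by simp
  then have "h * (h * S) \<le> h * (\<Delta>p\<^sup>2 / r / 2)"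
    using h by (intro mult_left_mono) auto
  moreover define X where "X = \<Delta>p\<^sup>2 * h / r"
  ultimately have hS: "h * (h * S) \<le> X / 2"
    by (simp add: mult.commute)
  have "X \<ge> 0"
    using h \<open>r > 0\<close> by (simp add: X_def)
  have "1 / 2 * a j * (us j - c / a j)\<^sup>2 = h * (h * ((x j)\<^sup>2 / a j)) / 2" for j
    unfolding dev using a[rule_format, of j] by (simp add: power2_eq_square field_simps)
  then have "cost a (\<lambda>j. us j - c / a j) = h * (h * S) / 2"
    by (simp add: cost_def S_def sum_distrib_left sum_divide_distrib)
  also have "\<dots> \<le> X"
    using hS \<open>X \<ge> 0\<close> by simp
  \<comment> \<open>The bound \<open>hS\<close> even gives \<open>X / 4\<close>; the factor
    \<open>4 * real CARD('v)\<close> in the claim is slack.\<close>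
  also have "\<dots> \<le> 4 * real CARD('v) * X"
    using mult_right_mono[of 1 "4 * real CARD('v)" X] n \<open>X \<ge> 0\<close> by simp
  finally show ?thesis
    using cost_eq_deviation[OF a sum_us] optimal_cost_eq[OF a B E sum_p]
    by (simp add: c_def A_def r_def X_def mult_ac)
qed

end
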